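(* Let $\Omega$ be a class with operation $\lor$, neutral element $\varnothing$, isomorphism relation $\cong$, relation $\ll$ and induced relation $\approx$ as described in the context, and let $\perp\!\!\!\perp$ be a ternary relation on $\Omega$ that is invariant under $\cong$ and under $\approx$ in each of its three arguments and satisfies the symmetric separoid rules (S1)–(S5). Fix $\tau\in\Omega$ such that $\tau\ll\tau$ and $\tau\lor\tau\approx\tau$, and define the $\tau$-shifted relation $$\alpha\perp\!\!\!\perp^\tau\beta\mid\gamma\quad:\iff\quad\alpha\perp\!\!\!\perp\tau\lor\beta\mid\gamma.$$ Then $\perp\!\!\!\perp^\tau$ is a $\tau$-$\varnothing$-separoid, i.e. it is invariant under $\cong$ and $\approx$ in all three arguments and satisfies the rules a)–k) listed in the context (with $\kappa=\varnothing$). It also satisfies, for all $\alpha,\beta,\gamma\in\Omega$: l) $(\alpha\perp\!\!\!\perp^\tau\beta\mid\gamma)\land(\beta\perp\!\!\!\perp^\tau\varnothing\mid\gamma)\implies\beta\perp\!\!\!\perp^\tau\alpha\mid\gamma$; m) $\alpha\perp\!\!\!\perp^\tau\beta\mid\gamma\lor\tau\implies\beta\perp\!\!\!\perp^\tau\alpha\mid\gamma\lor\tau$; n) if $\tau\cong\varnothing$, then $\alpha\perp\!\!\!\perp^\tau\beta\mid\gamma\implies\beta\perp\!\!\!\perp^\tau\alpha\mid\gamma$. If $\perp\!\!\!\perp$ in addition satisfies (S6) Composition, then $\perp\!\!\!\perp^\tau$ also satisfies, for all $\alpha,\beta,\gamma,\delta\in\Omega$, Left Composition $(\alpha\perp\!\!\!\perp^\tau\beta\mid\gamma)\land(\delta\perp\!\!\!\perp^\tau\beta\mid\gamma)\implies\alpha\lor\delta\perp\!\!\!\perp^\tau\beta\mid\gamma$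 and Right Composition $(\alpha\perp\!\!\!\perp^\tau\beta\mid\gamma)\land(\alpha\perp\!\!\!\perp^\tau\delta\mid\gamma)\implies\alpha\perp\!\!\!\perp^\tau\beta\lor\delta\mid\gamma$.
   Context: Setting. $\Omega$ is a class with a fixed notion of isomorphism $\cong$ (an equivalence relation respected by $\lor$), an operation $\lor$ that is associative and commutative up to $\cong$, an element $\varnothing$ neutral for $\lor$ up to $\cong$, and a transitive relation $\ll$ that is compatible with $\cong$ (i.e. $\alpha\ll\beta$, $\alpha\cong\alpha'$, $\beta\cong\beta'$ imply $\alpha'\ll\beta'$) and satisfies product extension: $\alpha\ll\beta\implies\alpha\ll\beta\lor\gamma$. $\ll$ is not assumed reflexive. Write $\alpha\approx\beta:\iff(\alpha\ll\beta)\land(\beta\ll\alpha)$. Invariance of a ternary relation under $\cong$ (resp. $\approx$) in an argument means its truth value does not change when that argument is replaced by a $\cong$- (resp. $\approx$-) related one. Symmetric separoid rules (for all $\alpha,\beta,\gamma,\delta\in\Omega$): (S1) Symmetry: $\alpha\perp\!\!\!\perp\beta\mid\gamma\implies\beta\perp\!\!\!\perp\alpha\mid\gamma$; (S2) Redundancy: $\alpha\ll\gamma\implies\alpha\perp\!\!\!\perp\beta\mid\gamma$; (S3) Decomposition: $\alpha\perp\!\!\!\perp\beta\lor\delta\mid\gamma\implies\alpha\perp\!\!\!\perp\beta\mid\gamma$; (S4) Weak Union: $\alpha\perp\!\!\!\perp\beta\lor\delta\mid\gamma\implies\alpha\perp\!\!\!\perp\beta\mid\delta\lor\gamma$; (S5)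 Contraction: $(\alpha\perp\!\!\!\perp\beta\mid\delta\lor\gamma)\land(\alpha\perp\!\!\!\perp\delta\mid\gamma)\implies\alpha\perp\!\!\!\perp\beta\lor\delta\mid\gamma$; (S6) Composition: $(\alpha\perp\!\!\!\perp\beta\mid\gamma)\land(\alpha\perp\!\!\!\perp\delta\mid\gamma)\implies\alpha\perp\!\!\!\perp\beta\lor\delta\mid\gamma$. $\tau$-$\kappa$-separoid. Let $\tau,\kappa\in\Omega$ with $\tau\ll\tau$ and $\tau\lor\tau\approx\tau$. A ternary relation $\perp$ on $\Omega$, written $\alpha\perp\beta\mid\gamma$ below, is a $\tau$-$\kappa$-separoid if it is invariant under $\cong$ and $\approx$ in all three arguments and satisfies for all $\alpha,\beta,\gamma,\delta\in\Omega$: a) $\alpha\ll\gamma\implies\alpha\perp\beta\mid\gamma$; b) $\alpha\perp\kappa\mid\gamma\lor\tau$; c) $\alpha\lor\delta\perp\beta\mid\gamma\implies\delta\perp\beta\mid\gamma$; d) $\alpha\perp\beta\lor\delta\mid\gamma\implies\alpha\perp\delta\mid\gamma$; e) $\alpha\perp\beta\mid\gamma\implies\alpha\perp\tau\lor\beta\mid\gamma$; f) $\alpha\lor\delta\perp\beta\mid\gamma\implies\alpha\perp\beta\mid\delta\lor\gamma$; g) $\alpha\perp\beta\lor\delta\mid\gamma\implies\alpha\perp\beta\mid\delta\lor\gamma$; h) $(\alpha\perp\beta\mid\delta\lor\gamma)\land(\delta\perp\beta\mid\gamma)\implies\alpha\lor\delta\perp\beta\mid\gamma$; i) $(\alpha\perp\beta\mid\delta\lor\gamma)\land(\alpha\perp\delta\mid\gamma)\implies\alpha\perp\beta\lor\delta\mid\gamma$;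 j) $(\alpha\perp\beta\mid\delta\lor\gamma)\land(\delta\perp\alpha\mid\gamma)\implies\alpha\perp\beta\lor\delta\mid\gamma$; k) $(\alpha\perp\beta\mid\delta\lor\gamma)\land(\beta\perp\delta\mid\gamma)\implies\beta\perp\alpha\lor\delta\mid\gamma$. *)

theory Defs
  imports Main
begin

text \<open>
  The class \<open>\<Omega>\<close> is rendered as a type. A ternary relation \<open>ind\<close> is written in prefix form:
  \<open>ind \<alpha> \<beta> \<gamma>\<close> reads ``\<open>\<alpha>\<close> is independent of \<open>\<beta>\<close> given \<open>\<gamma>\<close>''.
\<close>

definition mutual :: "('a \<Rightarrow> 'a \<Rightarrow> bool) \<Rightarrow> 'a \<Rightarrow> 'a \<Rightarrow> bool" where
  "mutual ll \<alpha> \<beta> \<longleftrightarrow> ll \<alpha> \<beta> \<and> ll \<beta> \<alpha>"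

definition invariant3 :: "('a \<Rightarrow> 'a \<Rightarrow> bool) \<Rightarrow> ('a \<Rightarrow> 'a \<Rightarrow> 'a \<Rightarrow> bool) \<Rightarrow> bool" where
  "invariant3 R ind \<longleftrightarrow>
     (\<forall>\<alpha> \<alpha>' \<beta> \<gamma>. R \<alpha> \<alpha>' \<longrightarrow> (ind \<alpha> \<beta> \<gamma> \<longleftrightarrow> ind \<alpha>' \<beta> \<gamma>)) \<and>
     (\<forall>\<alpha> \<beta> \<beta>' \<gamma>. R \<beta> \<beta>' \<longrightarrow> (ind \<alpha> \<beta> \<gamma> \<longleftrightarrow> ind \<alpha> \<beta>' \<gamma>)) \<and>
     (\<forall>\<alpha> \<beta> \<gamma> \<gamma>'. R \<gamma> \<gamma>' \<longrightarrow> (ind \<alpha> \<beta> \<gamma> \<longleftrightarrow> ind \<alpha> \<beta> \<gamma>'))"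

definition shift :: "('a \<Rightarrow> 'a \<Rightarrow> 'a) \<Rightarrow> 'a \<Rightarrow> ('a \<Rightarrow> 'a \<Rightarrow> 'a \<Rightarrow> bool) \<Rightarrow> 'a \<Rightarrow> 'a \<Rightarrow> 'a \<Rightarrow> bool" where
  "shift join \<tau> ind \<alpha> \<beta> \<gamma> \<longleftrightarrow> ind \<alpha> (join \<tau> \<beta>) \<gamma>"

text \<open>The relation \<open>\<lless>\<close> is not assumed to be reflexive.\<close>

locale separoid_base =
  fixes iso :: "'a \<Rightarrow> 'a \<Rightarrow> bool"  (infix "\<cong>" 50)
    and join :: "'a \<Rightarrow> 'a \<Rightarrow> 'a"  (infixl "\<squnion>" 65)
    and emp :: 'a  ("\<emptyset>")
    and ll :: "'a \<Rightarrow> 'a \<Rightarrow> bool"  (infix "\<lless>" 50)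
  assumes iso_equivp: "equivp (\<cong>)"
    and join_cong: "\<alpha> \<cong> \<alpha>' \<Longrightarrow> \<beta> \<cong> \<beta>' \<Longrightarrow> \<alpha> \<squnion> \<beta> \<cong> \<alpha>' \<squnion> \<beta>'"
    and join_assoc: "(\<alpha> \<squnion> \<beta>) \<squnion> \<gamma> \<cong> \<alpha> \<squnion> (\<beta> \<squnion> \<gamma>)"
    and join_commute: "\<alpha> \<squnion> \<beta> \<cong> \<beta> \<squnion> \<alpha>"
    and join_emp_left: "\<emptyset> \<squnion> \<alpha> \<cong> \<alpha>"
    and join_emp_right: "\<alpha> \<squnion> \<emptyset> \<cong> \<alpha>"
    and ll_transp: "transp (\<lless>)"
    and ll_iso: "\<alpha> \<lless> \<beta> \<Longrightarrow> \<alpha> \<cong> \<alpha>' \<Longrightarrow> \<beta> \<cong> \<beta>' \<Longrightarrow> \<alpha>' \<lless> \<beta>'"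
    and product_extension: "\<alpha> \<lless> \<beta> \<Longrightarrow> \<alpha> \<lless> \<beta> \<squnion> \<gamma>"
begin

abbreviation approx :: "'a \<Rightarrow> 'a \<Rightarrow> bool"  (infix "\<approx>" 50) where
  "(\<approx>) \<equiv> mutual (\<lless>)"

end

locale symmetric_separoid = separoid_base +
  fixes ind :: "'a \<Rightarrow> 'a \<Rightarrow> 'a \<Rightarrow> bool"
  assumes inv_iso: "invariant3 (\<cong>) ind"
    and inv_approx: "invariant3 (\<approx>) ind"
    and symmetry: "ind \<alpha> \<beta> \<gamma> \<Longrightarrow> ind \<beta> \<alpha> \<gamma>"
    and redundancy: "\<alpha> \<lless> \<gamma> \<Longrightarrow> ind \<alpha> \<beta> \<gamma>"
    and decomposition: "ind \<alpha> (\<beta> \<squnion> \<delta>) \<gamma> \<Longrightarrow> ind \<alpha> \<beta> \<gamma>"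
    and weak_union: "ind \<alpha> (\<beta> \<squnion> \<delta>) \<gamma> \<Longrightarrow> ind \<alpha> \<beta> (\<delta> \<squnion> \<gamma>)"
    and contraction: "ind \<alpha> \<beta> (\<delta> \<squnion> \<gamma>) \<Longrightarrow> ind \<alpha> \<delta> \<gamma> \<Longrightarrow> ind \<alpha> (\<beta> \<squnion> \<delta>) \<gamma>"

locale tau_kappa_separoid = separoid_base +
  fixes \<tau> \<kappa> :: 'a
    and ind :: "'a \<Rightarrow> 'a \<Rightarrow> 'a \<Rightarrow> bool"
  assumes tau_refl: "\<tau> \<lless> \<tau>"
    and tau_idem: "\<tau> \<squnion> \<tau> \<approx> \<tau>"
    and inv_iso: "invariant3 (\<cong>) ind"
    and inv_approx: "invariant3 (\<approx>) ind"
    and left_redundancy: "\<alpha> \<lless> \<gamma> \<Longrightarrow> ind \<alpha> \<beta> \<gamma>"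
    and right_redundancy: "ind \<alpha> \<kappa> (\<gamma> \<squnion> \<tau>)"
    and left_decomposition: "ind (\<alpha> \<squnion> \<delta>) \<beta> \<gamma> \<Longrightarrow> ind \<delta> \<beta> \<gamma>"
    and right_decomposition: "ind \<alpha> (\<beta> \<squnion> \<delta>) \<gamma> \<Longrightarrow> ind \<alpha> \<delta> \<gamma>"
    and tau_inverted_right_decomposition: "ind \<alpha> \<beta> \<gamma> \<Longrightarrow> ind \<alpha> (\<tau> \<squnion> \<beta>) \<gamma>"
    and left_weak_union: "ind (\<alpha> \<squnion> \<delta>) \<beta> \<gamma> \<Longrightarrow> ind \<alpha> \<beta> (\<delta> \<squnion> \<gamma>)"
    and right_weak_union: "ind \<alpha> (\<beta> \<squnion> \<delta>) \<gamma> \<Longrightarrow> ind \<alpha> \<beta> (\<delta> \<squnion> \<gamma>)"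
    and left_contraction:
      "ind \<alpha> \<beta> (\<delta> \<squnion> \<gamma>) \<Longrightarrow> ind \<delta> \<beta> \<gamma> \<Longrightarrow> ind (\<alpha> \<squnion> \<delta>) \<beta> \<gamma>"
    and right_contraction:
      "ind \<alpha> \<beta> (\<delta> \<squnion> \<gamma>) \<Longrightarrow> ind \<alpha> \<delta> \<gamma> \<Longrightarrow> ind \<alpha> (\<beta> \<squnion> \<delta>) \<gamma>"
    and right_cross_contraction:
      "ind \<alpha> \<beta> (\<delta> \<squnion> \<gamma>) \<Longrightarrow> ind \<delta> \<alpha> \<gamma> \<Longrightarrow> ind \<alpha> (\<beta> \<squnion> \<delta>) \<gamma>"
    and flipped_left_cross_contraction:
      "ind \<alpha> \<beta> (\<delta> \<squnion> \<gamma>) \<Longrightarrow> ind \<beta> \<delta> \<gamma> \<Longrightarrow> ind \<beta> (\<alpha> \<squnion> \<delta>) \<gamma>"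

end

theory Submission
  imports Defs
begin

text \<open>
  The proof rests on splitting a composite argument: contraction together with its converses,
  decomposition and weak union, makes \<open>ind \<alpha> (\<beta> \<squnion> \<delta>) \<gamma>\<close> equivalent to
  \<open>ind \<alpha> \<delta> \<gamma> \<and> ind \<alpha> \<beta> (\<delta> \<squnion> \<gamma>)\<close> (\<open>ind_join_iff\<close>). Applied to \<open>\<tau> \<squnion> \<beta>\<close>, it says that
  the shifted relation is \<open>ind \<alpha> \<tau> \<gamma>\<close>, in which \<open>\<beta>\<close> does not occur, together with the
  relation \<open>ind \<alpha> \<beta> (\<tau> \<squnion> \<gamma>)\<close>, which is symmetric in \<open>\<alpha>\<close> and \<open>\<beta>\<close> (\<open>shift_iff\<close>). So the
  only obstruction to symmetry of the shifted relation is the first conjunct, and it holds by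
  redundancy as soon as \<open>\<tau>\<close> is part of the condition.

  The rules acting on the left argument alone are the symmetric mirror images of rules for
  \<open>ind\<close>; the others follow by splitting \<open>\<tau> \<squnion> \<dots>\<close> at a suitable place, since joins may be
  reassociated and permuted under invariance. The one place where invariance must be derived
  differently is \<open>\<approx>\<close> in the second argument: \<open>\<beta> \<approx> \<beta>'\<close> need not imply
  \<open>\<tau> \<squnion> \<beta> \<approx> \<tau> \<squnion> \<beta>'\<close>, because \<open>\<lless>\<close> is not assumed to be compatible with joins. In the split
  form, \<open>\<beta>\<close> is a whole argument and the invariance of \<open>ind\<close> itself applies.
\<close>

context symmetric_separoid
begin

lemma iso_sym: "\<alpha> \<cong> \<beta> \<Longrightarrow> \<beta> \<cong> \<alpha>"
  using iso_equivp by (rule equivp_symp)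

lemma iso_refl: "\<alpha> \<cong> \<alpha>"
  using iso_equivp by (rule equivp_reflp)

lemma ind_cong_mid: "\<beta> \<cong> \<beta>' \<Longrightarrow> ind \<alpha> \<beta> \<gamma> \<longleftrightarrow> ind \<alpha> \<beta>' \<gamma>"
  using inv_iso unfolding invariant3_def by blast

lemma ind_cong_right: "\<gamma> \<cong> \<gamma>' \<Longrightarrow> ind \<alpha> \<beta> \<gamma> \<longleftrightarrow> ind \<alpha> \<beta> \<gamma>'"
  using inv_iso unfolding invariant3_def by blast

lemma mid_commute: "ind \<alpha> (\<beta> \<squnion> \<delta>) \<gamma> \<longleftrightarrow> ind \<alpha> (\<delta> \<squnion> \<beta>) \<gamma>"
  by (rule ind_cong_mid[OF join_commute])

lemma mid_assoc: "ind \<alpha> ((\<beta> \<squnion> \<delta>) \<squnion> \<epsilon>) \<gamma> \<longleftrightarrow> ind \<alpha> (\<beta> \<squnion> (\<delta> \<squnion> \<epsilon>)) \<gamma>"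
  by (rule ind_cong_mid[OF join_assoc])

lemma mid_left_commute: "ind \<alpha> (\<beta> \<squnion> (\<delta> \<squnion> \<epsilon>)) \<gamma> \<longleftrightarrow> ind \<alpha> (\<delta> \<squnion> (\<beta> \<squnion> \<epsilon>)) \<gamma>"
proof -
  have "ind \<alpha> (\<beta> \<squnion> (\<delta> \<squnion> \<epsilon>)) \<gamma> \<longleftrightarrow> ind \<alpha> ((\<beta> \<squnion> \<delta>) \<squnion> \<epsilon>) \<gamma>"
    by (simp only: mid_assoc)
  also have "\<dots> \<longleftrightarrow> ind \<alpha> ((\<delta> \<squnion> \<beta>) \<squnion> \<epsilon>) \<gamma>"
    by (rule ind_cong_mid[OF join_cong[OF join_commute iso_refl]])
  finally show ?thesis
    by (simp only: mid_assoc)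
qed

lemma right_assoc: "ind \<alpha> \<beta> ((\<delta> \<squnion> \<epsilon>) \<squnion> \<gamma>) \<longleftrightarrow> ind \<alpha> \<beta> (\<delta> \<squnion> (\<epsilon> \<squnion> \<gamma>))"
  by (rule ind_cong_right[OF join_assoc])

lemma decomposition_left: "ind (\<alpha> \<squnion> \<delta>) \<beta> \<gamma> \<Longrightarrow> ind \<delta> \<beta> \<gamma>"
  using decomposition mid_commute symmetry by blast

lemma ind_join_iff: "ind \<alpha> (\<beta> \<squnion> \<delta>) \<gamma> \<longleftrightarrow> ind \<alpha> \<delta> \<gamma> \<and> ind \<alpha> \<beta> (\<delta> \<squnion> \<gamma>)"
  using contraction weak_union decomposition mid_commute by blast

lemma shift_iff:
  "shift (\<squnion>) \<tau> ind \<alpha> \<beta> \<gamma> \<longleftrightarrow> ind \<alpha> \<tau> \<gamma> \<and> ind \<alpha> \<beta> (\<tau> \<squnion> \<gamma>)"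
  unfolding shift_def ind_join_iff[symmetric] by (rule mid_commute)

lemma shift_invariant_iso: "invariant3 (\<cong>) (shift (\<squnion>) \<tau> ind)"
  using inv_iso join_cong[OF iso_refl] unfolding invariant3_def shift_def by blast

lemma shift_invariant_approx: "invariant3 (\<approx>) (shift (\<squnion>) \<tau> ind)"
proof -
  have "shift (\<squnion>) \<tau> ind \<alpha> \<beta> \<gamma> \<longleftrightarrow> shift (\<squnion>) \<tau> ind \<alpha> \<beta>' \<gamma>" if "\<beta> \<approx> \<beta>'" for \<alpha> \<beta> \<beta>' \<gamma>
    unfolding shift_iff using that inv_approx unfolding invariant3_def by blast
  moreover have "shift (\<squnion>) \<tau> ind \<alpha> \<beta> \<gamma> \<longleftrightarrow> shift (\<squnion>) \<tau> ind \<alpha>' \<beta> \<gamma>" if "\<alpha> \<approx> \<alpha>'" for \<alpha> \<alpha>' \<beta> \<gamma>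
    unfolding shift_def using that inv_approx unfolding invariant3_def by blast
  moreover have "shift (\<squnion>) \<tau> ind \<alpha> \<beta> \<gamma> \<longleftrightarrow> shift (\<squnion>) \<tau> ind \<alpha> \<beta> \<gamma>'" if "\<gamma> \<approx> \<gamma>'" for \<alpha> \<beta> \<gamma> \<gamma>'
    unfolding shift_def using that inv_approx unfolding invariant3_def by blast
  ultimately show ?thesis
    unfolding invariant3_def by blast
qed

text \<open>
  The first conjunct of \<open>shift_iff\<close> is trivial for a condition containing \<open>\<tau>\<close>; this is
  where \<open>\<tau> \<lless> \<tau>\<close> enters, as \<open>\<lless>\<close> need not be reflexive.
\<close>
lemma ind_tau:
  assumes "\<tau> \<lless> \<tau>"
  shows "ind \<alpha> \<tau> (\<tau> \<squnion> \<gamma>)" and "ind \<alpha> \<tau> (\<gamma> \<squnion> \<tau>)"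
proof -
  show "ind \<alpha> \<tau> (\<tau> \<squnion> \<gamma>)" for \<alpha> \<gamma>
    using assms product_extension redundancy symmetry by blast
  then show "ind \<alpha> \<tau> (\<gamma> \<squnion> \<tau>)"
    using ind_cong_right[OF join_commute] by blast
qed

lemma shift_tau_idem:
  assumes refl: "\<tau> \<lless> \<tau>" and shift: "shift (\<squnion>) \<tau> ind \<alpha> \<beta> \<gamma>"
  shows "shift (\<squnion>) \<tau> ind \<alpha> (\<tau> \<squnion> \<beta>) \<gamma>"
proof -
  have "ind \<alpha> \<tau> (\<beta> \<squnion> (\<tau> \<squnion> \<gamma>))"
    using ind_tau(1)[OF refl] ind_cong_right[OF iso_sym[OF join_assoc]]
      ind_cong_right[OF join_cong[OF join_commute iso_refl]] right_assoc by blast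
  then show ?thesis
    using shift unfolding shift_iff by (simp add: ind_join_iff)
qed

lemma shift_symmetric:
  assumes "shift (\<squnion>) \<tau> ind \<alpha> \<beta> \<gamma>" and "ind \<beta> \<tau> \<gamma>"
  shows "shift (\<squnion>) \<tau> ind \<beta> \<alpha> \<gamma>"
  using assms symmetry unfolding shift_iff by blast

text \<open>
  All contractions on the right reduce to this one: \<open>\<delta>\<close> can be moved between the condition
  and the second argument because \<open>\<tau>\<close> already accompanies \<open>\<beta>\<close>, so the plain relation
  \<open>ind \<alpha> \<delta> \<gamma>\<close> suffices. It yields the cross contraction by symmetry of \<open>ind\<close>.
\<close>
lemma shift_contraction:
  assumes "shift (\<squnion>) \<tau> ind \<alpha> \<beta> (\<delta> \<squnion> \<gamma>)" and "ind \<alpha> \<delta> \<gamma>"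
  shows "shift (\<squnion>) \<tau> ind \<alpha> (\<beta> \<squnion> \<delta>) \<gamma>"
  using assms contraction mid_assoc unfolding shift_def by blast

lemma shift_imp_ind: "shift (\<squnion>) \<tau> ind \<alpha> \<beta> \<gamma> \<Longrightarrow> ind \<alpha> \<beta> \<gamma>"
  unfolding shift_def using decomposition mid_commute by blast

text \<open>
  Here the split is at \<open>\<tau> \<squnion> \<delta>\<close> instead of at \<open>\<tau>\<close>: given \<open>\<tau> \<squnion> \<delta> \<squnion> \<gamma>\<close> the first premise
  can be flipped, and the second premise is exactly independence of \<open>\<beta>\<close> from \<open>\<tau> \<squnion> \<delta>\<close>.
\<close>
lemma shift_flipped_contraction:
  assumes "shift (\<squnion>) \<tau> ind \<alpha> \<beta> (\<delta> \<squnion> \<gamma>)" and "shift (\<squnion>) \<tau> ind \<beta> \<delta> \<gamma>"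
  shows "shift (\<squnion>) \<tau> ind \<beta> (\<alpha> \<squnion> \<delta>) \<gamma>"
proof -
  have "ind \<beta> \<alpha> ((\<tau> \<squnion> \<delta>) \<squnion> \<gamma>)"
    using assms(1) symmetry unfolding shift_iff right_assoc by blast
  moreover have "ind \<beta> (\<tau> \<squnion> \<delta>) \<gamma>"
    using assms(2) unfolding shift_def .
  ultimately show ?thesis
    unfolding shift_def using contraction mid_left_commute by blast
qed

theorem shift_tau_empty_separoid:
  assumes "\<tau> \<lless> \<tau>" and "\<tau> \<squnion> \<tau> \<approx> \<tau>"
  shows "tau_kappa_separoid (\<cong>) (\<squnion>) \<emptyset> (\<lless>) \<tau> \<emptyset> (shift (\<squnion>) \<tau> ind)"
proof (unfold_locales)
  show "\<tau> \<lless> \<tau>" and "\<tau> \<squnion> \<tau> \<approx> \<tau>"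
    by (fact assms)+
  show "invariant3 (\<cong>) (shift (\<squnion>) \<tau> ind)" and "invariant3 (\<approx>) (shift (\<squnion>) \<tau> ind)"
    by (fact shift_invariant_iso shift_invariant_approx)+
next
  fix \<alpha> \<beta> \<gamma>
  assume "\<alpha> \<lless> \<gamma>"
  then show "shift (\<squnion>) \<tau> ind \<alpha> \<beta> \<gamma>"
    unfolding shift_def by (rule redundancy)
next
  fix \<alpha> \<gamma>
  show "shift (\<squnion>) \<tau> ind \<alpha> \<emptyset> (\<gamma> \<squnion> \<tau>)"
    unfolding shift_def using ind_tau(2)[OF assms(1)] ind_cong_mid[OF join_emp_right] by blast
next
  fix \<alpha> \<beta> \<gamma> \<delta>
  assume "shift (\<squnion>) \<tau> ind (\<alpha> \<squnion> \<delta>) \<beta> \<gamma>"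
  then show "shift (\<squnion>) \<tau> ind \<delta> \<beta> \<gamma>" and "shift (\<squnion>) \<tau> ind \<alpha> \<beta> (\<delta> \<squnion> \<gamma>)"
    unfolding shift_def using decomposition_left weak_union symmetry by blast+
next
  fix \<alpha> \<beta> \<gamma> \<delta>
  assume prem: "shift (\<squnion>) \<tau> ind \<alpha> (\<beta> \<squnion> \<delta>) \<gamma>"
  then show "shift (\<squnion>) \<tau> ind \<alpha> \<delta> \<gamma>"
    unfolding shift_def using mid_left_commute mid_commute decomposition by blast
  show "shift (\<squnion>) \<tau> ind \<alpha> \<beta> (\<delta> \<squnion> \<gamma>)"
    using prem weak_union mid_assoc unfolding shift_def by blast
next
  fix \<alpha> \<beta> \<gamma>
  assume "shift (\<squnion>) \<tau> ind \<alpha> \<beta> \<gamma>"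
  with assms(1) show "shift (\<squnion>) \<tau> ind \<alpha> (\<tau> \<squnion> \<beta>) \<gamma>"
    by (rule shift_tau_idem)
next
  fix \<alpha> \<beta> \<gamma> \<delta>
  assume prem: "shift (\<squnion>) \<tau> ind \<alpha> \<beta> (\<delta> \<squnion> \<gamma>)"
  show "shift (\<squnion>) \<tau> ind (\<alpha> \<squnion> \<delta>) \<beta> \<gamma>" if "shift (\<squnion>) \<tau> ind \<delta> \<beta> \<gamma>"
    using prem that contraction symmetry unfolding shift_def by blast
  show "shift (\<squnion>) \<tau> ind \<alpha> (\<beta> \<squnion> \<delta>) \<gamma>" if "shift (\<squnion>) \<tau> ind \<alpha> \<delta> \<gamma>"
    using prem shift_imp_ind[OF that] by (rule shift_contraction)
  show "shift (\<squnion>) \<tau> ind \<alpha> (\<beta> \<squnion> \<delta>) \<gamma>" if "shift (\<squnion>) \<tau> ind \<delta> \<alpha> \<gamma>"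
    using prem symmetry[OF shift_imp_ind[OF that]] by (rule shift_contraction)
  show "shift (\<squnion>) \<tau> ind \<beta> (\<alpha> \<squnion> \<delta>) \<gamma>" if "shift (\<squnion>) \<tau> ind \<beta> \<delta> \<gamma>"
    using prem that by (rule shift_flipped_contraction)
qed

end

theorem theoremI1:
  fixes iso :: "'a \<Rightarrow> 'a \<Rightarrow> bool"  (infix "\<cong>" 50)
    and join :: "'a \<Rightarrow> 'a \<Rightarrow> 'a"  (infixl "\<squnion>" 65)
    and emp :: 'a  ("\<emptyset>")
    and ll :: "'a \<Rightarrow> 'a \<Rightarrow> bool"  (infix "\<lless>" 50)
    and ind :: "'a \<Rightarrow> 'a \<Rightarrow> 'a \<Rightarrow> bool"
    and \<tau> :: 'a
  assumes "symmetric_separoid (\<cong>) (\<squnion>) \<emptyset> (\<lless>) ind"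
    and "\<tau> \<lless> \<tau>"
    and "mutual (\<lless>) (\<tau> \<squnion> \<tau>) \<tau>"
  shows "tau_kappa_separoid (\<cong>) (\<squnion>) \<emptyset> (\<lless>) \<tau> \<emptyset> (shift (\<squnion>) \<tau> ind) \<and>
    (\<forall>\<alpha> \<beta> \<gamma>. shift (\<squnion>) \<tau> ind \<alpha> \<beta> \<gamma> \<and> shift (\<squnion>) \<tau> ind \<beta> \<emptyset> \<gamma> \<longrightarrow>
       shift (\<squnion>) \<tau> ind \<beta> \<alpha> \<gamma>) \<and>
    (\<forall>\<alpha> \<beta> \<gamma>. shift (\<squnion>) \<tau> ind \<alpha> \<beta> (\<gamma> \<squnion> \<tau>) \<longrightarrow> shift (\<squnion>) \<tau> ind \<beta> \<alpha> (\<gamma> \<squnion> \<tau>)) \<and>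
    (\<tau> \<cong> \<emptyset> \<longrightarrow>
       (\<forall>\<alpha> \<beta> \<gamma>. shift (\<squnion>) \<tau> ind \<alpha> \<beta> \<gamma> \<longrightarrow> shift (\<squnion>) \<tau> ind \<beta> \<alpha> \<gamma>)) \<and>
    ((\<forall>\<alpha> \<beta> \<gamma> \<delta>. ind \<alpha> \<beta> \<gamma> \<and> ind \<alpha> \<delta> \<gamma> \<longrightarrow> ind \<alpha> (\<beta> \<squnion> \<delta>) \<gamma>) \<longrightarrow>
       (\<forall>\<alpha> \<beta> \<gamma> \<delta>. shift (\<squnion>) \<tau> ind \<alpha> \<beta> \<gamma> \<and> shift (\<squnion>) \<tau> ind \<delta> \<beta> \<gamma> \<longrightarrow>
          shift (\<squnion>) \<tau> ind (\<alpha> \<squnion> \<delta>) \<beta> \<gamma>) \<and>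
       (\<forall>\<alpha> \<beta> \<gamma> \<delta>. shift (\<squnion>) \<tau> ind \<alpha> \<beta> \<gamma> \<and> shift (\<squnion>) \<tau> ind \<alpha> \<delta> \<gamma> \<longrightarrow>
          shift (\<squnion>) \<tau> ind \<alpha> (\<beta> \<squnion> \<delta>) \<gamma>))"
proof -
  interpret symmetric_separoid "(\<cong>)" "(\<squnion>)" \<emptyset> "(\<lless>)" ind
    by (fact assms(1))
  have restricted: "shift (\<squnion>) \<tau> ind \<beta> \<alpha> \<gamma>"
    if "shift (\<squnion>) \<tau> ind \<alpha> \<beta> \<gamma>" and "shift (\<squnion>) \<tau> ind \<beta> \<emptyset> \<gamma>" for \<alpha> \<beta> \<gamma>
    using that shift_symmetric unfolding shift_iff[of \<tau> \<beta> \<emptyset>] by blast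
  have given_tau: "shift (\<squnion>) \<tau> ind \<beta> \<alpha> (\<gamma> \<squnion> \<tau>)"
    if "shift (\<squnion>) \<tau> ind \<alpha> \<beta> (\<gamma> \<squnion> \<tau>)" for \<alpha> \<beta> \<gamma>
    using that ind_tau(2)[OF assms(2)] by (rule shift_symmetric)
  have trivial_tau: "shift (\<squnion>) \<tau> ind \<beta> \<alpha> \<gamma>"
    if "\<tau> \<cong> \<emptyset>" and "shift (\<squnion>) \<tau> ind \<alpha> \<beta> \<gamma>" for \<alpha> \<beta> \<gamma>
  proof -
    \<comment> \<open>Since \<open>\<emptyset> \<lless> \<gamma>\<close> may fail, independence of \<open>\<emptyset>\<close> is obtained by decomposing \<open>\<emptyset> \<squnion> \<alpha>\<close>.\<close>
    have "ind \<beta> \<alpha> \<gamma>"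
      using shift_imp_ind[OF that(2)] by (rule symmetry)
    then have "ind \<beta> \<emptyset> \<gamma>"
      using ind_cong_mid[OF join_emp_left] decomposition by blast
    then have "ind \<beta> \<tau> \<gamma>"
      using ind_cong_mid[OF that(1)] by blast
    with that(2) show ?thesis
      by (rule shift_symmetric)
  qed
  have left_comp: "shift (\<squnion>) \<tau> ind (\<alpha> \<squnion> \<delta>) \<beta> \<gamma>"
    if "\<forall>\<alpha> \<beta> \<gamma> \<delta>. ind \<alpha> \<beta> \<gamma> \<and> ind \<alpha> \<delta> \<gamma> \<longrightarrow> ind \<alpha> (\<beta> \<squnion> \<delta>) \<gamma>"
      and "shift (\<squnion>) \<tau> ind \<alpha> \<beta> \<gamma>" and "shift (\<squnion>) \<tau> ind \<delta> \<beta> \<gamma>" for \<alpha> \<beta> \<gamma> \<delta>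
    using that symmetry unfolding shift_def by blast
  have right_comp: "shift (\<squnion>) \<tau> ind \<alpha> (\<beta> \<squnion> \<delta>) \<gamma>"
    if "\<forall>\<alpha> \<beta> \<gamma> \<delta>. ind \<alpha> \<beta> \<gamma> \<and> ind \<alpha> \<delta> \<gamma> \<longrightarrow> ind \<alpha> (\<beta> \<squnion> \<delta>) \<gamma>"
      and "shift (\<squnion>) \<tau> ind \<alpha> \<beta> \<gamma>" and "shift (\<squnion>) \<tau> ind \<alpha> \<delta> \<gamma>" for \<alpha> \<beta> \<gamma> \<delta>
    using that(1,2) shift_imp_ind[OF that(3)] mid_assoc unfolding shift_def by blast
  show ?thesis
    using shift_tau_empty_separoid[OF assms(2,3)] restricted given_tau trivial_tau
      left_comp right_comp by (intro conjI allI impI) blast+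
qed

end
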